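(* Let $S=\{s_1,s_2,s_3,\dots\}$ with $s_n=\left\lfloor (3/2)^n\right\rfloor$ for $n=1,2,3,\dots$. For $\alpha>0$ let $S_\alpha=\{\lfloor \alpha s_1\rfloor,\lfloor \alpha s_2\rfloor,\lfloor \alpha s_3\rfloor,\dots\}$. Then for every real $\alpha$ with $0<\alpha<1$, $\{2^3,2^4\}\not\subseteq S_\alpha$.
   Context: $\lfloor x\rfloor$ denotes the floor (integer part) of a real number $x$. *)

theory Defs
  imports Complex_Main
begin

definition s :: "nat \<Rightarrow> int" where
  "s n = \<lfloor>(3 / 2 :: real) ^ n\<rfloor>"

definition S_scaled :: "real \<Rightarrow> int set" where
  "S_scaled \<alpha> = {\<lfloor>\<alpha> * real_of_int (s n)\<rfloor> | n. n \<ge> 1}"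

end

theory Submission
  imports Defs
begin

text \<open>
  If \<open>\<lfloor>\<alpha> s\<^sub>m\<rfloor> = 8\<close> and \<open>\<lfloor>\<alpha> s\<^sub>n\<rfloor> = 16\<close>, then \<open>16/9 < s\<^sub>n / s\<^sub>m < 17/8\<close>, while \<open>\<alpha> < 1\<close> forces
  \<open>s\<^sub>m \<ge> 9\<close>. For such \<open>s\<^sub>m\<close> rounding is too small an effect to move a ratio into that window:
  \<open>s\<^sub>n / s\<^sub>m < 5/3\<close> for \<open>n \<le> m + 1\<close>, and \<open>s\<^sub>n / s\<^sub>m > 77/36\<close> for \<open>n \<ge> m + 2\<close>.
\<close>

lemma s_le_power: "real_of_int (s n) \<le> (3 / 2) ^ n"
  unfolding s_def by simp

lemma power_less_s_plus_1: "(3 / 2) ^ n < real_of_int (s n) + 1"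
  unfolding s_def by simp

lemma s_ratio_upper:
  assumes "9 \<le> s m" and "n \<le> m + 1"
  shows "real_of_int (s n) < 5 / 3 * real_of_int (s m)"
proof -
  have "real_of_int (s n) \<le> (3 / 2) ^ n"
    by (rule s_le_power)
  also have "\<dots> \<le> (3 / 2) ^ (m + 1)"
    using assms(2) by (intro power_increasing) auto
  also have "\<dots> = 3 / 2 * (3 / 2) ^ m"
    by simp
  also have "\<dots> < 3 / 2 * (real_of_int (s m) + 1)"
    using power_less_s_plus_1[of m] by simp
  \<comment> \<open>Here 5/3 = 3/2 * (1 + 1/9), and \<open>s m + 1\<close> is at most 1 + 1/9 times
    \<open>s m\<close>.\<close>
  also have "\<dots> \<le> 5 / 3 * real_of_int (s m)"
    using assms(1) by simp
  finally show ?thesis .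
qed

lemma s_ratio_lower:
  assumes "9 \<le> s m" and "m + 2 \<le> n"
  shows "77 / 36 * real_of_int (s m) < real_of_int (s n)"
proof -
  \<comment> \<open>Here 77/36 = 9/4 - 1/9: a ninth of \<open>s m\<close> absorbs the loss from the
    floor of the larger power.\<close>
  have "77 / 36 * real_of_int (s m) \<le> 9 / 4 * real_of_int (s m) - 1"
    using assms(1) by simp
  also have "\<dots> \<le> 9 / 4 * (3 / 2) ^ m - 1"
    using s_le_power[of m] by simp
  also have "\<dots> = (3 / 2) ^ (m + 2) - 1"
    by (simp add: power_add power2_eq_square)
  also have "\<dots> \<le> (3 / 2) ^ n - 1"
    using power_increasing[OF assms(2), of "3 / 2 :: real"] by simp
  also have "\<dots> < real_of_int (s n)"
    using power_less_s_plus_1[of n] by simp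
  finally show ?thesis .
qed

theorem theorem2p1:
  fixes \<alpha> :: real
  assumes "0 < \<alpha>" and "\<alpha> < 1"
  shows "\<not> {2 ^ 3, 2 ^ 4} \<subseteq> S_scaled \<alpha>"
proof
  assume "{2 ^ 3, 2 ^ 4} \<subseteq> S_scaled \<alpha>"
  then obtain m n where "\<lfloor>\<alpha> * real_of_int (s m)\<rfloor> = 8" and "\<lfloor>\<alpha> * real_of_int (s n)\<rfloor> = 16"
    unfolding S_scaled_def by auto
  then have m: "8 \<le> \<alpha> * real_of_int (s m)" "\<alpha> * real_of_int (s m) < 9"
    and n: "16 \<le> \<alpha> * real_of_int (s n)" "\<alpha> * real_of_int (s n) < 17"
    by (simp_all add: floor_eq_iff)
  have "0 < \<alpha> * real_of_int (s m)"
    using m(1) by linarith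
  then have "0 < real_of_int (s m)"
    using assms(1) by (simp add: zero_less_mult_iff)
  then have "\<alpha> * real_of_int (s m) < real_of_int (s m)"
    using assms(2) by simp
  \<comment> \<open>\<open>s m\<close> is an integer exceeding 8.\<close>
  then have s_m: "9 \<le> s m"
    using m(1) by linarith
  show False
  proof (cases "n \<le> m + 1")
    case True
    have "\<alpha> * real_of_int (s n) < \<alpha> * (5 / 3 * real_of_int (s m))"
      using s_ratio_upper[OF s_m True] assms(1) by (rule mult_strict_left_mono)
    \<comment> \<open>The right side is below 5/3 * 9 = 15 < 16.\<close>
    then show False
      using m(2) n(1) by simp
  next
    case False
    then have "m + 2 \<le> n"
      by simp
    then have "\<alpha> * (77 / 36 * real_of_int (s m)) < \<alpha> * real_of_int (s n)"
      using s_ratio_lower[OF s_m] assms(1) by (intro mult_strict_left_mono)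
    \<comment> \<open>The left side is at least 77/36 * 8 = 154/9 > 17.\<close>
    then show False
      using m(1) n(2) by simp
  qed
qed

end
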